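(* For every positive integer $n$, the simplified graph of overlapping permutations $SP(n)$ is word-representable.
   Context: Graph of overlapping permutations: for a positive integer $n$, $P(n)$ is the directed graph whose vertex set is the set of all $n!$ permutations of $\{1,2,\ldots,n\}$ (written as words $x_1x_2\ldots x_n$), with an arc from $x_1x_2\ldots x_n$ to $y_1y_2\ldots y_n$ if and only if for all $2\le i<j\le n$ either both $x_i<x_j$ and $y_{i-1}<y_{j-1}$ hold, or both $x_i>x_j$ and $y_{i-1}>y_{j-1}$ hold (loops may occur). The simplified graph of overlapping permutations $SP(n)$ is the simple undirected graph obtained from $P(n)$ by removing orientations and loops and replacing multiple edges between a pair of vertices by a single edge. That is, two distinct permutations are adjacent in $SP(n)$ if and only if there is an arc of $P(n)$ between them in at least one direction. Word-representability: two distinct letters $x$ and $y$ alternate in a word $w$ if, after deleting from $w$ all letters other than the copies of $x$ and $y$, one obtains either a word $xyxy\cdots$ or a word $yxyx\cdots$ (of even or odd length). A simple graph $G=(V,E)$ is word-representable if there exists a (finite) word $w$ over the alphabet $V$, in which every letter of $V$ occurs, such that for all $x\ne y$ in $V$, the letters $x$ and $y$ alternate in $w$ if and only if $xy\in E$. *)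

theory Defs
  imports "HOL-Combinatorics.Multiset_Permutations" "Graph_Theory.Graph_Theory"
begin

text \<open>Lists are indexed from 0, so the letter \<open>x\<^sub>i\<close> of a word \<open>x\<close> is \<open>x ! (i - 1)\<close> and
  \<open>y\<^bsub>i - 1\<^esub>\<close> is \<open>y ! (i - 2)\<close>.\<close>

definition overlap_arc :: "nat \<Rightarrow> nat list \<Rightarrow> nat list \<Rightarrow> bool" where
  "overlap_arc n x y \<longleftrightarrow>
     (\<forall>i j. 2 \<le> i \<and> i < j \<and> j \<le> n \<longrightarrow>
        (x ! (i - 1) < x ! (j - 1) \<and> y ! (i - 2) < y ! (j - 2)) \<or>
        (x ! (i - 1) > x ! (j - 1) \<and> y ! (i - 2) > y ! (j - 2)))"

definition overlap_perm_graph :: "nat \<Rightarrow> nat list pair_pre_digraph" where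
  "overlap_perm_graph n =
     \<lparr> pverts = permutations_of_set {1..n},
       parcs = {(x, y). x \<in> permutations_of_set {1..n} \<and> y \<in> permutations_of_set {1..n} \<and>
                        overlap_arc n x y} \<rparr>"

text \<open>Following the graph library, a simple undirected graph is a finite loop-free digraph with a
  symmetric arc relation (locale \<^locale>\<open>pair_graph\<close>).\<close>

definition underlying_simple_graph :: "'a pair_pre_digraph \<Rightarrow> 'a pair_pre_digraph" where
  "underlying_simple_graph G =
     \<lparr> pverts = pverts G,
       parcs = {(x, y). (x, y) \<in> parcs (mk_symmetric (with_proj G)) \<and> x \<noteq> y} \<rparr>"

definition simplified_overlap_perm_graph :: "nat \<Rightarrow> nat list pair_pre_digraph" where
  "simplified_overlap_perm_graph n = underlying_simple_graph (overlap_perm_graph n)"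

definition alternating_word :: "'a \<Rightarrow> 'a \<Rightarrow> nat \<Rightarrow> 'a list" where
  "alternating_word x y k = map (\<lambda>i. if even i then x else y) [0..<k]"

definition alternate_in :: "'a \<Rightarrow> 'a \<Rightarrow> 'a list \<Rightarrow> bool" where
  "alternate_in x y w \<longleftrightarrow>
     (\<exists>k. filter (\<lambda>z. z = x \<or> z = y) w = alternating_word x y k \<or>
          filter (\<lambda>z. z = x \<or> z = y) w = alternating_word y x k)"

text \<open>Intended for graphs satisfying \<^locale>\<open>pair_graph\<close>.\<close>

definition word_representable :: "'a pair_pre_digraph \<Rightarrow> bool" where
  "word_representable G \<longleftrightarrow>
     (\<exists>w. set w = pverts G \<and>
          (\<forall>x \<in> pverts G. \<forall>y \<in> pverts G. x \<noteq> y \<longrightarrow>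
             (alternate_in x y w \<longleftrightarrow> (x, y) \<in> parcs G)))"

lemma simplified_overlap_perm_graph_arc_iff:
  "(x, y) \<in> parcs (simplified_overlap_perm_graph n) \<longleftrightarrow>
     x \<in> permutations_of_set {1..n} \<and> y \<in> permutations_of_set {1..n} \<and> x \<noteq> y \<and>
     (overlap_arc n x y \<or> overlap_arc n y x)"
  by (auto simp: simplified_overlap_perm_graph_def underlying_simple_graph_def
      overlap_perm_graph_def parcs_mk_symmetric)

lemma pverts_simplified_overlap_perm_graph:
  "pverts (simplified_overlap_perm_graph n) = permutations_of_set {1..n}"
  by (simp add: simplified_overlap_perm_graph_def underlying_simple_graph_def
      overlap_perm_graph_def)

lemma pair_graph_simplified_overlap_perm_graph:
  "pair_graph (simplified_overlap_perm_graph n)"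
proof -
  let ?G = "simplified_overlap_perm_graph n"
  have "parcs ?G \<subseteq> permutations_of_set {1..n} \<times> permutations_of_set {1..n}"
    by (auto simp: simplified_overlap_perm_graph_arc_iff)
  then have "finite (parcs ?G)"
    by (rule finite_subset) simp
  then show ?thesis
    by unfold_locales
      (auto simp: pverts_simplified_overlap_perm_graph simplified_overlap_perm_graph_arc_iff
        symmetric_def arcs_ends_conv sym_def)
qed

end

theory Submission
  imports Defs
begin

text \<open>
  Replacing a permutation by its word of ascents and descents turns overlaps of permutations into
  overlaps of binary words. Colour a binary word by the parity of the length of its first run: a
  run of even length gets colour 2, a run of odd length gets the colour 0 or 1 of its letter.
  Unless a constant word is shifted to itself, a shift either shortens the first run by one or
  starts a run of the other letter, so the colour changes; and a constant word belongs to a single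
  permutation. Hence the graph is 3-colourable.

  For a 3-coloured graph with colour classes \<open>A, B, C\<close>, a representing word is a concatenation of
  words in each of which every edge \<open>xy\<close> with \<open>x\<close> of smaller colour than \<open>y\<close> induces
  \<open>xy\<dots>xy\<close>. Every non-edge has to be broken by one of these words. The word
  \<open>A B C A\<^sup>R B\<^sup>R C\<^sup>R\<close> does this for two vertices of the same colour. For a non-edge between
  consecutive classes append to \<open>A B C\<close> a copy of it with the two vertices swapped at the border of
  their classes, and for a non-edge \<open>ac\<close> between \<open>A\<close> and \<open>C\<close> take
  \<open>A B (C - c) a c (A - a) B C\<close>.
\<close>

section \<open>Alternation\<close>

lemma alternating_word_Suc:
  "alternating_word x y (Suc k) = x # alternating_word y x k"
  unfolding alternating_word_def
  by (simp add: upt_conv_Cons map_Suc_upt[symmetric] del: upt_Suc)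

lemma alternating_word_0: "alternating_word x y 0 = []"
  by (simp add: alternating_word_def)

lemma successively_alternating_word:
  assumes "x \<noteq> y"
  shows "successively (\<noteq>) (alternating_word x y k)"
proof -
  \<comment> \<open>Each unfolding swaps the two letters, so the induction also needs that an
    \<open>x\<close> may be put in front of the word starting with \<open>y\<close>.\<close>
  have "successively (\<noteq>) (alternating_word x y k) \<and> successively (\<noteq>) (x # alternating_word y x k)"
    using assms
    by (induction k arbitrary: x y) (auto simp: alternating_word_Suc alternating_word_0)
  then show ?thesis by simp
qed

lemma alternate_in_successively:
  assumes "x \<noteq> y" "alternate_in x y w"
  shows "successively (\<noteq>) (filter (\<lambda>z. z = x \<or> z = y) w)"
  using assms successively_alternating_word[of x y] successively_alternating_word[of y x]
  unfolding alternate_in_def by metis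

text \<open>A square \<open>zz\<close> survives in the restriction of every word around
  \<open>v\<close>, so one bad factor settles a non-edge whatever the other pieces are.\<close>

lemma alternate_in_factor:
  assumes "x \<noteq> y" "alternate_in x y (p @ v @ q)"
    and "filter (\<lambda>z. z = x \<or> z = y) v = r @ [z, z] @ s"
  shows False
  using alternate_in_successively[OF assms(1,2)] assms(3)
  by (simp add: successively_append_iff)

lemma alternate_in_commute: "alternate_in x y w = alternate_in y x w"
proof -
  have "(\<lambda>z. z = x \<or> z = y) = (\<lambda>z. z = y \<or> z = x)" by auto
  then show ?thesis unfolding alternate_in_def by metis
qed

text \<open>Unlike alternation, this property is closed under concatenation, since every block
  starts with \<open>x\<close> and ends with \<open>y\<close>.\<close>

definition pair_power :: "'a \<Rightarrow> 'a \<Rightarrow> 'a list \<Rightarrow> bool" where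
  "pair_power x y w \<longleftrightarrow> (\<exists>k. filter (\<lambda>z. z = x \<or> z = y) w = concat (replicate k [x, y]))"

lemma pair_power_imp_alternate_in:
  assumes "pair_power x y w"
  shows "alternate_in x y w"
proof -
  have "concat (replicate k [x, y]) = alternating_word x y (2 * k)" for k
    by (induction k) (auto simp: alternating_word_Suc alternating_word_0)
  then show ?thesis
    using assms unfolding pair_power_def alternate_in_def by metis
qed

lemma pair_power_append:
  assumes "pair_power x y v" "pair_power x y w"
  shows "pair_power x y (v @ w)"
  using assms unfolding pair_power_def
  by (metis concat_append filter_append replicate_add)

lemma pair_power_concat:
  assumes "\<And>w. w \<in> set ws \<Longrightarrow> pair_power x y w"
  shows "pair_power x y (concat ws)"
  using assms
proof (induction ws)
  case Nil
  show ?case unfolding pair_power_def by (intro exI[of _ 0]) simp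
qed (auto intro: pair_power_append)

lemma pair_powerI:
  assumes "filter (\<lambda>z. z = x \<or> z = y) w = [x, y] \<or>
    filter (\<lambda>z. z = x \<or> z = y) w = [x, y, x, y]"
  shows "pair_power x y w"
proof -
  have "[x, y] = concat (replicate 1 [x, y])" "[x, y, x, y] = concat (replicate 2 [x, y])"
    by (simp_all add: numeral_2_eq_2)
  with assms show ?thesis unfolding pair_power_def by metis
qed

section \<open>Representing a 3-coloured graph\<close>

text \<open>The order on colours orients every edge, so all pieces agree on which endpoint comes
  first and can be concatenated. The word \<open>u\<close> makes every vertex occur, even if there
  are no non-edges.\<close>

lemma word_representable_if_pieces:
  fixes col :: "'a \<Rightarrow> 'b :: linorder"
  assumes "pair_graph G"
    and colouring: "\<And>x y. (x, y) \<in> parcs G \<Longrightarrow> col x \<noteq> col y"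
    and "set u = pverts G"
    and u: "\<And>x y. (x, y) \<in> parcs G \<Longrightarrow> col x < col y \<Longrightarrow> pair_power x y u"
    and pieces: "\<And>a b. a \<in> pverts G \<Longrightarrow> b \<in> pverts G \<Longrightarrow> a \<noteq> b \<Longrightarrow> (a, b) \<notin> parcs G \<Longrightarrow>
      col a \<le> col b \<Longrightarrow>
      \<exists>v r z s. set v \<subseteq> pverts G \<and> filter (\<lambda>c. c = a \<or> c = b) v = r @ [z, z] @ s \<and>
        (\<forall>x y. (x, y) \<in> parcs G \<longrightarrow> col x < col y \<longrightarrow> pair_power x y v)"
  shows "word_representable G"
proof -
  interpret pair_graph G by fact
  \<comment> \<open>Up to swapping its ends, every non-edge is in \<open>N\<close>; inside a colour
    class both orientations are.\<close>
  define N where "N = {(a, b). a \<in> pverts G \<and> b \<in> pverts G \<and> a \<noteq> b \<and>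
    (a, b) \<notin> parcs G \<and> col a \<le> col b}"
  have "finite N"
    by (rule finite_subset[of _ "pverts G \<times> pverts G"]) (auto simp: N_def)
  then obtain ns where ns: "set ns = N"
    using finite_list by blast
  have "\<forall>p \<in> N. \<exists>v. set v \<subseteq> pverts G \<and>
      (\<exists>r z s. filter (\<lambda>c. c = fst p \<or> c = snd p) v = r @ [z, z] @ s) \<and>
      (\<forall>x y. (x, y) \<in> parcs G \<longrightarrow> col x < col y \<longrightarrow> pair_power x y v)"
  proof
    fix p assume "p \<in> N"
    then show "\<exists>v. set v \<subseteq> pverts G \<and>
      (\<exists>r z s. filter (\<lambda>c. c = fst p \<or> c = snd p) v = r @ [z, z] @ s) \<and>
      (\<forall>x y. (x, y) \<in> parcs G \<longrightarrow> col x < col y \<longrightarrow> pair_power x y v)"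
      using pieces[of "fst p" "snd p"] unfolding N_def by auto
  qed
  then obtain f where f: "\<forall>p \<in> N. set (f p) \<subseteq> pverts G \<and>
      (\<exists>r z s. filter (\<lambda>c. c = fst p \<or> c = snd p) (f p) = r @ [z, z] @ s) \<and>
      (\<forall>x y. (x, y) \<in> parcs G \<longrightarrow> col x < col y \<longrightarrow> pair_power x y (f p))"
    by (rule bchoice[THEN exE])
  define w where "w = u @ concat (map f ns)"
  have "set w = pverts G"
    using f ns \<open>set u = pverts G\<close> unfolding w_def by auto
  have edge: "alternate_in x y w" if "(x, y) \<in> parcs G" "col x < col y" for x y
    unfolding w_def using that f ns
    by (intro pair_power_imp_alternate_in pair_power_append u pair_power_concat) auto
  have non_edge: "\<not> alternate_in x y w" if xy: "(x, y) \<in> N" for x y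
  proof
    assume alt: "alternate_in x y w"
    have "(x, y) \<in> set ns" using ns that by simp
    then obtain ns1 ns2 where "ns = ns1 @ (x, y) # ns2"
      by (meson split_list)
    then have factor: "alternate_in x y ((u @ concat (map f ns1)) @ f (x, y) @ concat (map f ns2))"
      using alt by (simp add: w_def)
    obtain r z s where square: "filter (\<lambda>c. c = x \<or> c = y) (f (x, y)) = r @ [z, z] @ s"
      using bspec[OF f xy] unfolding fst_conv snd_conv by blast
    have "x \<noteq> y" using xy by (simp add: N_def)
    then show False using factor square by (rule alternate_in_factor)
  qed
  have sym: "(y, x) \<in> parcs G" if "(x, y) \<in> parcs G" for x y
    using that sym_arcs by (auto simp: symmetric_def arcs_ends_conv sym_def)
  have "alternate_in x y w \<longleftrightarrow> (x, y) \<in> parcs G"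
    if "x \<in> pverts G" "y \<in> pverts G" "x \<noteq> y" for x y
  proof (cases "(x, y) \<in> parcs G")
    case True
    then consider "col x < col y" | "col y < col x"
      using colouring by (meson neqE)
    then show ?thesis
      using True edge sym alternate_in_commute by metis
  next
    case False
    then have "(x, y) \<in> N \<or> (y, x) \<in> N"
      using that sym unfolding N_def by auto
    then show ?thesis
      using False non_edge alternate_in_commute by metis
  qed
  with \<open>set w = pverts G\<close> show ?thesis
    unfolding word_representable_def by blast
qed

lemma filter_pair_fst:
  assumes "distinct xs" "x \<in> set xs" "y \<notin> set xs"
  shows "filter (\<lambda>z. z = x \<or> z = y) xs = [x]"
  using assms by (induction xs) (auto simp: filter_empty_conv)

lemma filter_pair_snd:
  assumes "distinct xs" "y \<in> set xs" "x \<notin> set xs"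
  shows "filter (\<lambda>z. z = x \<or> z = y) xs = [y]"
  using filter_pair_fst[OF assms] by (simp add: disj_commute)

lemma filter_pair_none:
  assumes "x \<notin> set xs" "y \<notin> set xs"
  shows "filter (\<lambda>z. z = x \<or> z = y) xs = []"
  using assms by (auto simp: filter_empty_conv)

text \<open>These rules evaluate the restriction of a piece to two letters block by block, as each
  block is a list without repetitions.\<close>

lemmas filter_pair = filter_pair_fst filter_pair_snd filter_pair_none

theorem word_representable_if_3_colourable:
  fixes col :: "'a \<Rightarrow> nat"
  assumes "pair_graph G"
    and colouring: "\<And>x y. (x, y) \<in> parcs G \<Longrightarrow> col x \<noteq> col y"
    and three: "\<And>x. x \<in> pverts G \<Longrightarrow> col x < 3"
  shows "word_representable G"
proof -
  interpret pair_graph G by fact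
  obtain vs where vs: "set vs = pverts G" "distinct vs"
    using finite_distinct_list[OF finite_verts] by auto
  define A B C where "A = filter (\<lambda>x. col x = 0) vs" and "B = filter (\<lambda>x. col x = 1) vs"
    and "C = filter (\<lambda>x. col x = 2) vs"
  have dist: "distinct A" "distinct B" "distinct C"
    using vs(2) by (simp_all add: A_def B_def C_def)
  have mem: "x \<in> set A \<longleftrightarrow> x \<in> pverts G \<and> col x = 0" "x \<in> set B \<longleftrightarrow> x \<in> pverts G \<and> col x = 1"
    "x \<in> set C \<longleftrightarrow> x \<in> pverts G \<and> col x = 2" for x
    using vs(1) by (auto simp: A_def B_def C_def)
  note piece_simps = mem dist filter_pair
  have edge_cases: "x \<in> pverts G \<and> y \<in> pverts G \<and>
      (col x = 0 \<and> col y = 1 \<or> col x = 1 \<and> col y = 2 \<or> col x = 0 \<and> col y = 2)"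
    if "(x, y) \<in> parcs G" "col x < col y" for x y
  proof -
    have "x \<in> pverts G" "y \<in> pverts G"
      using arc_fst_in_verts[OF that(1)] arc_snd_in_verts[OF that(1)] by simp_all
    then show ?thesis using three[of y] that(2) by auto
  qed
  let ?u = "A @ B @ C @ rev A @ rev B @ rev C"
  have u: "pair_power x y ?u" if "(x, y) \<in> parcs G" "col x < col y" for x y
    using edge_cases[OF that] by (intro pair_powerI) (auto simp: piece_simps)
  show ?thesis
  proof (rule word_representable_if_pieces[of G col ?u])
    show "set ?u = pverts G"
      using three by (force simp: mem)
  next
    fix a b
    assume ab: "a \<in> pverts G" "b \<in> pverts G" "a \<noteq> b" "(a, b) \<notin> parcs G" "col a \<le> col b"
    let ?broken = "\<lambda>v. \<exists>r z s. filter (\<lambda>c. c = a \<or> c = b) v = r @ [z, z] @ s"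
    let ?good = "\<lambda>v. \<forall>x y. (x, y) \<in> parcs G \<longrightarrow> col x < col y \<longrightarrow> pair_power x y v"
    have "\<exists>v. set v \<subseteq> pverts G \<and> ?broken v \<and> ?good v"
    proof -
      consider "col a = col b" | "col a = 0" "col b = 1" | "col a = 1" "col b = 2"
        | "col a = 0" "col b = 2"
        using three[OF ab(2)] ab(5) by linarith
      then show ?thesis
      proof cases
        case 1
        \<comment> \<open>The square is the last letter of \<open>f\<close> meeting its mirror
          image.\<close>
        have mirror: "\<exists>r z s. f @ rev f = r @ [z, z] @ s" if "f \<noteq> []" for f :: "'a list"
          using that by (cases f rule: rev_cases) auto
        let ?f = "filter (\<lambda>c. c = a \<or> c = b)"
        have "col a < 3" using three ab(1) by blast
        then consider "col a = 0" | "col a = 1" | "col a = 2" by linarith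
        then obtain D where D: "?f ?u = ?f D @ rev (?f D)" "a \<in> set D"
        proof cases
          case 1
          with ab \<open>col a = col b\<close> show ?thesis
            by (intro that[of A]) (auto simp: mem filter_pair_none rev_filter[symmetric])
        next
          case 2
          with ab \<open>col a = col b\<close> show ?thesis
            by (intro that[of B]) (auto simp: mem filter_pair_none rev_filter[symmetric])
        next
          case 3
          with ab \<open>col a = col b\<close> show ?thesis
            by (intro that[of C]) (auto simp: mem filter_pair_none rev_filter[symmetric])
        qed
        have "?broken ?u"
          unfolding D(1) by (rule mirror) (use D(2) in \<open>auto simp: filter_empty_conv\<close>)
        then show ?thesis
          using u by (intro exI[of _ ?u]) (auto simp: mem)
      next
        case 2
        \<comment> \<open>Restricted to \<open>a\<close> and \<open>b\<close> this reads
          \<open>abba\<close>. The swap changes the order of no other pair from different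
          classes.\<close>
        let ?v = "A @ B @ C @ remove1 a A @ [b, a] @ remove1 b B @ C"
        have "?broken ?v"
          using 2 ab by (intro exI[of _ "[a]"] exI[of _ b]) (auto simp: piece_simps)
        moreover have "?good ?v"
        proof (intro allI impI pair_powerI)
          fix x y assume e: "(x, y) \<in> parcs G" "col x < col y"
          then have "x \<noteq> a \<or> y \<noteq> b" using ab by auto
          from edge_cases[OF e] have "x \<in> pverts G" "y \<in> pverts G" by simp_all
          from edge_cases[OF e] consider "col x = 0" "col y = 1" | "col x = 1" "col y = 2"
            | "col x = 0" "col y = 2" by auto
          then show "filter (\<lambda>z. z = x \<or> z = y) ?v = [x, y] \<or>
              filter (\<lambda>z. z = x \<or> z = y) ?v = [x, y, x, y]"
            using 2 ab \<open>x \<noteq> a \<or> y \<noteq> b\<close> \<open>x \<in> pverts G\<close> \<open>y \<in> pverts G\<close>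
            by cases (cases "x = a"; cases "y = a"; cases "x = b"; cases "y = b";
              simp add: piece_simps)+
        qed
        ultimately show ?thesis
          using ab by (intro exI[of _ ?v]) (auto simp: mem dist)
      next
        case 3
        let ?v = "A @ B @ C @ A @ remove1 a B @ [b, a] @ remove1 b C"
        have "?broken ?v"
          using 3 ab by (intro exI[of _ "[a]"] exI[of _ b]) (auto simp: piece_simps)
        moreover have "?good ?v"
        proof (intro allI impI pair_powerI)
          fix x y assume e: "(x, y) \<in> parcs G" "col x < col y"
          then have "x \<noteq> a \<or> y \<noteq> b" using ab by auto
          from edge_cases[OF e] have "x \<in> pverts G" "y \<in> pverts G" by simp_all
          from edge_cases[OF e] consider "col x = 0" "col y = 1" | "col x = 1" "col y = 2"
            | "col x = 0" "col y = 2" by auto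
          then show "filter (\<lambda>z. z = x \<or> z = y) ?v = [x, y] \<or>
              filter (\<lambda>z. z = x \<or> z = y) ?v = [x, y, x, y]"
            using 3 ab \<open>x \<noteq> a \<or> y \<noteq> b\<close> \<open>x \<in> pverts G\<close> \<open>y \<in> pverts G\<close>
            by cases (cases "x = a"; cases "y = a"; cases "x = b"; cases "y = b";
              simp add: piece_simps)+
        qed
        ultimately show ?thesis
          using ab by (intro exI[of _ ?v]) (auto simp: mem dist)
      next
        case 4
        \<comment> \<open>At the seam of two copies of \<open>A @ B @ C\<close> the classes
          \<open>C\<close> and \<open>A\<close> meet, so \<open>b\<close> and the next
          \<open>a\<close> can be swapped without crossing \<open>B\<close>. The restriction becomes
          \<open>aabb\<close>.\<close>
        let ?v = "A @ B @ remove1 b C @ [a, b] @ remove1 a A @ B @ C"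
        have "?broken ?v"
          by (rule exI[of _ "[]"], rule exI[of _ a], rule exI[of _ "[b, b]"])
            (use 4 ab in \<open>auto simp: piece_simps\<close>)
        moreover have "?good ?v"
        proof (intro allI impI pair_powerI)
          fix x y assume e: "(x, y) \<in> parcs G" "col x < col y"
          then have "x \<noteq> a \<or> y \<noteq> b" using ab by auto
          from edge_cases[OF e] have "x \<in> pverts G" "y \<in> pverts G" by simp_all
          from edge_cases[OF e] consider "col x = 0" "col y = 1" | "col x = 1" "col y = 2"
            | "col x = 0" "col y = 2" by auto
          then show "filter (\<lambda>z. z = x \<or> z = y) ?v = [x, y] \<or>
              filter (\<lambda>z. z = x \<or> z = y) ?v = [x, y, x, y]"
            using 4 ab \<open>x \<noteq> a \<or> y \<noteq> b\<close> \<open>x \<in> pverts G\<close> \<open>y \<in> pverts G\<close>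
            by cases (cases "x = a"; cases "y = a"; cases "x = b"; cases "y = b";
              simp add: piece_simps)+
        qed
        ultimately show ?thesis
          using ab by (intro exI[of _ ?v]) (auto simp: mem dist)
      qed
    qed
    then show "\<exists>v r z s. set v \<subseteq> pverts G \<and> filter (\<lambda>c. c = a \<or> c = b) v = r @ [z, z] @ s \<and>
        (\<forall>x y. (x, y) \<in> parcs G \<longrightarrow> col x < col y \<longrightarrow> pair_power x y v)"
      by blast
  qed (use assms u in auto)
qed

section \<open>Colouring permutations\<close>

text \<open>Prepending a letter equal to the head toggles the parity of the first run. The empty
  word counts as a run of even length 0.\<close>

fun run_colour :: "bool list \<Rightarrow> nat" where
  "run_colour [] = 2"
| "run_colour (a # w) =
    (if w \<noteq> [] \<and> hd w = a \<and> run_colour w \<noteq> 2 then 2 else of_bool a)"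

lemma run_colour_less: "run_colour w < 3"
  by (cases w) auto

text \<open>The first run has ended by the last letter of \<open>a # w\<close>, so \<open>b\<close>
  cannot lengthen it.\<close>

lemma run_colour_snoc:
  assumes "\<not> set (w @ [b]) \<subseteq> {a}"
  shows "run_colour (a # w @ [b]) = run_colour (a # w)"
  using assms
proof (induction w)
  case (Cons c w)
  then show ?case by (cases "c = a") auto
qed auto

lemma run_colour_shift:
  assumes "\<not> set (w @ [b]) \<subseteq> {a}"
  shows "run_colour (a # w) \<noteq> run_colour (w @ [b])"
proof (cases w)
  case Nil
  with assms show ?thesis by auto
next
  case (Cons c v)
  show ?thesis
  proof (cases "c = a")
    case True
    \<comment> \<open>With \<open>b\<close> dropped, the comparison is between \<open>a # w\<close>
      and \<open>w\<close>, whose first runs differ in length by one.\<close>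
    then have "run_colour (w @ [b]) = run_colour w"
      using run_colour_snoc[of v b a] assms Cons by auto
    then show ?thesis using Cons True by (simp del: run_colour.simps(2)) (auto)
  qed (use Cons in auto)
qed

definition ascents :: "nat list \<Rightarrow> bool list" where
  "ascents x = map (\<lambda>i. x ! i < x ! Suc i) [0..<length x - 1]"

text \<open>A constant ascent word forces the increasing or the decreasing arrangement of
  \<open>S\<close>. This disposes of the case that \<open>run_colour_shift\<close> excludes.\<close>

lemma permutation_eq_if_ascents_constant:
  assumes "x \<in> permutations_of_set S" "y \<in> permutations_of_set S"
    and "set (ascents x) \<subseteq> {a}" "set (ascents y) \<subseteq> {a}"
  shows "x = y"
proof -
  have xy: "set x = set y" "distinct x" "distinct y"
    using assms(1,2) by (auto simp: permutations_of_set_def)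
  have asc: "z ! i < z ! Suc i \<longleftrightarrow> a" if "set (ascents z) \<subseteq> {a}" "Suc i < length z" for z i
  proof -
    have "(z ! i < z ! Suc i) \<in> set (ascents z)"
      unfolding ascents_def set_map using that(2) by (intro imageI) simp
    from subsetD[OF that(1) this] show ?thesis by simp
  qed
  show ?thesis
  proof (cases a)
    case True
    have "sorted z" if "set (ascents z) \<subseteq> {a}" for z
      using asc[OF that] True by (simp add: sorted_iff_nth_Suc less_imp_le)
    then show ?thesis
      using assms(3,4) xy by (intro sorted_distinct_set_unique) simp_all
  next
    case False
    have "sorted (rev z)" if "set (ascents z) \<subseteq> {a}" for z
      using asc[OF that] False by (simp add: sorted_rev_iff_nth_Suc not_less)
    then have "rev x = rev y"
      using assms(3,4) xy by (intro sorted_distinct_set_unique) simp_all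
    then show ?thesis by simp
  qed
qed

text \<open>Only the comparisons of neighbouring positions in the arc condition are used.\<close>

lemma overlap_arc_ascents:
  assumes "overlap_arc n x y" "length x = n" "length y = n"
  shows "tl (ascents x) = butlast (ascents y)"
proof (rule nth_equalityI)
  show "length (tl (ascents x)) = length (butlast (ascents y))"
    using assms by (simp add: ascents_def)
next
  fix i assume i: "i < length (tl (ascents x))"
  then have bound: "i + 1 < n - 1" and "2 \<le> i + 2 \<and> i + 2 < i + 3 \<and> i + 3 \<le> n"
    using assms by (simp_all add: ascents_def)
  then have "x ! (i + 1) < x ! (i + 2) \<longleftrightarrow> y ! i < y ! (i + 1)"
    \<comment> \<open>The 1-based positions \<open>i + 2\<close> and \<open>i + 3\<close> are the
      list indices \<open>i + 1\<close>, \<open>i + 2\<close> in \<open>x\<close> and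
      \<open>i\<close>, \<open>i + 1\<close> in \<open>y\<close>.\<close>
    using assms(1)[unfolded overlap_arc_def, rule_format, of "i + 2" "i + 3"]
    by (auto simp: numeral_3_eq_3)
  then show "tl (ascents x) ! i = butlast (ascents y) ! i"
    using i bound assms by (simp add: ascents_def nth_tl nth_butlast)
qed

lemma overlap_arc_run_colour:
  assumes "x \<in> permutations_of_set {1..n}" "y \<in> permutations_of_set {1..n}"
    and "overlap_arc n x y" "x \<noteq> y"
  shows "run_colour (ascents x) \<noteq> run_colour (ascents y)"
proof -
  have len: "length x = n" "length y = n"
    using assms(1,2) length_finite_permutations_of_set by fastforce+
  \<comment> \<open>Empty ascent words are trivially constant, so \<open>x = y\<close> would
    follow.\<close>
  have "ascents x \<noteq> [] \<and> ascents y \<noteq> []"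
  proof (rule ccontr)
    assume "\<not> ?thesis"
    then have "ascents x = []" "ascents y = []"
      using len by (auto simp: ascents_def)
    then show False
      using permutation_eq_if_ascents_constant[OF assms(1,2)] assms(4) by auto
  qed
  then obtain a w b v where "ascents x = a # w" "ascents y = v @ [b]"
    by (metis append_butlast_last_id neq_Nil_conv)
  moreover from this have "v = w"
    using overlap_arc_ascents[OF assms(3) len] by simp
  moreover have "\<not> set (w @ [b]) \<subseteq> {a}"
  proof
    assume "set (w @ [b]) \<subseteq> {a}"
    then have "set (ascents x) \<subseteq> {a}" "set (ascents y) \<subseteq> {a}"
      using calculation by simp_all
    then show False
      using permutation_eq_if_ascents_constant[OF assms(1,2)] assms(4) by blast
  qed
  ultimately show ?thesis
    using run_colour_shift by metis
qed

theorem theorem4: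
  fixes n :: nat
  assumes "n \<ge> 1"
  shows "word_representable (simplified_overlap_perm_graph n)"
proof (rule word_representable_if_3_colourable)
  show "pair_graph (simplified_overlap_perm_graph n)"
    by (rule pair_graph_simplified_overlap_perm_graph)
  show "run_colour (ascents x) \<noteq> run_colour (ascents y)"
    if "(x, y) \<in> parcs (simplified_overlap_perm_graph n)" for x y
    \<comment> \<open>An edge may come from an arc in either direction; differing in colour is
      symmetric.\<close>
    using that overlap_arc_run_colour
    unfolding simplified_overlap_perm_graph_arc_iff by metis
qed (rule run_colour_less)

end
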